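(* Let $\mathcal G$ be a finite nonempty collection of allowed words of $\Sigma_A$ and let $r$ be the maximal length of a word in $\mathcal G$. Then the limit defining the escape rate $\rho(H_{\mathcal G})$ exists and $$\rho(H_{\mathcal G})=-\ln\lambda(B_{\mathcal G}\circ P_{r-1}),$$ where $\lambda(\cdot)$ denotes spectral radius and $\circ$ the Hadamard (entrywise) product (with the convention $P_0:=P$ when $r=1$). Moreover $\rho(H_{\mathcal G})>0$.
   Context: Let $\Sigma=\{1,\dots,N\}$ and let $A$ be an irreducible $N\times N$ matrix with entries in $\{0,1\}$ (for all $i,j$ there is $n\ge1$ with $(A^n)_{ij}>0$). The subshift of finite type is $\Sigma_A=\{x=(x_n)_{n\ge1}\in\Sigma^{\mathbb N}: A_{x_nx_{n+1}}=1\ \forall n\ge1\}$ with left shift $\sigma$. A finite word is allowed if it appears (as consecutive symbols) in some $x\in\Sigma_A$; $\mathcal L_n$ is the set of allowed words of length $n$. For an allowed word $w$, the cylinder $C_w$ is the set of $x\in\Sigma_A$ beginning with $w$. $P$ is an $N\times N$ row-stochastic matrix compatible with $A$ ($P_{ij}>0$ iff $A_{ij}=1$), $\mathbf p$ its stationary vector ($\mathbf p^TP=\mathbf p^T$, entries summing to 1), and $\mu=\mu_P$ the Markov measure with $\mu(C_w)=p_{w_1}P_{w_1w_2}\cdots P_{w_{n-1}w_n}$ for $w=w_1\cdots w_n$. For a finite collection $\mathcal G$ of allowed words, the Markov hole is $H_{\mathcal G}=\bigcup_{w\in\mathcal G}C_w$. For a hole $H$, $\mathcal W_m=\{x\in\Sigma_A:\sigma^ix\notin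 H \text{ for } 0\le i\le m\}$ and the escape rate is $\rho(H)=-\lim_{m\to\infty}\frac1m\ln\mu(\mathcal W_m)$. Higher block matrices: for $n\ge1$ and $X=x_1\cdots x_n,\ Y=y_1\cdots y_n\in\mathcal L_n$ with $x_2\cdots x_n=y_1\cdots y_{n-1}$ (vacuous if $n=1$) put $X*Y=x_1\cdots x_ny_n$. $P_n$ is the matrix indexed by $\mathcal L_n$ with $(P_n)_{XY}=P_{x_ny_n}$ if $x_2\cdots x_n=y_1\cdots y_{n-1}$ and $X*Y\in\mathcal L_{n+1}$, and $0$ otherwise ($P_1=P$). Adjacency matrix of the open system: if $r\ge2$, $B_{\mathcal G}$ is the $0$–$1$ matrix indexed by $\mathcal L_{r-1}$ with $(B_{\mathcal G})_{XY}=1$ iff $X*Y$ is defined, $X*Y\in\mathcal L_r$, and $X*Y$ contains no word of $\mathcal G$ as a subword; if $r=1$, $B_{\mathcal G}$ is indexed by $\Sigma$ with $(B_{\mathcal G})_{ij}=1$ iff $ij\in\mathcal L_2$ and $i,j\notin\mathcal G$. *)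

theory Defs
  imports "HOL-Analysis.Analysis" "HOL-Library.Sublist"
begin

(* Alphabet Sigma = a finite type 'a; matrices indexed by 'a are functions 'a => 'a => real.
   Sequences x :: nat => 'a are indexed from 0 (paper: from 1). *)

fun mpow :: "('a::finite \<Rightarrow> 'a \<Rightarrow> real) \<Rightarrow> nat \<Rightarrow> 'a \<Rightarrow> 'a \<Rightarrow> real" where
  "mpow M 0 = (\<lambda>i j. if i = j then 1 else 0)"
| "mpow M (Suc n) = (\<lambda>i j. \<Sum>k\<in>UNIV. mpow M n i k * M k j)"

definition irreducible_mat :: "('a::finite \<Rightarrow> 'a \<Rightarrow> real) \<Rightarrow> bool" where
  "irreducible_mat M \<longleftrightarrow> (\<forall>i j. \<exists>n\<ge>1. mpow M n i j > 0)"

definition SFT :: "('a \<Rightarrow> 'a \<Rightarrow> real) \<Rightarrow> (nat \<Rightarrow> 'a) set" where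
  "SFT A = {x. \<forall>n. A (x n) (x (Suc n)) = 1}"

definition shift :: "nat \<Rightarrow> (nat \<Rightarrow> 'a) \<Rightarrow> (nat \<Rightarrow> 'a)" where
  "shift i x = (\<lambda>n. x (n + i))"

definition allowed :: "('a \<Rightarrow> 'a \<Rightarrow> real) \<Rightarrow> 'a list \<Rightarrow> bool" where
  "allowed A w \<longleftrightarrow> (\<exists>x\<in>SFT A. \<exists>k. w = map x [k..<k + length w])"

definition Lang :: "('a \<Rightarrow> 'a \<Rightarrow> real) \<Rightarrow> nat \<Rightarrow> 'a list set" where
  "Lang A n = {w. length w = n \<and> allowed A w}"

definition cyl :: "('a \<Rightarrow> 'a \<Rightarrow> real) \<Rightarrow> 'a list \<Rightarrow> (nat \<Rightarrow> 'a) set" where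
  "cyl A w = {x\<in>SFT A. \<forall>i<length w. x i = w ! i}"

definition markov_cyl :: "('a \<Rightarrow> 'a \<Rightarrow> real) \<Rightarrow> ('a \<Rightarrow> real) \<Rightarrow> 'a list \<Rightarrow> real" where
  "markov_cyl P p w = p (hd w) * (\<Prod>i<length w - 1. P (w ! i) (w ! Suc i))"

definition hole :: "('a \<Rightarrow> 'a \<Rightarrow> real) \<Rightarrow> 'a list set \<Rightarrow> (nat \<Rightarrow> 'a) set" where
  "hole A G = (\<Union>w\<in>G. cyl A w)"

definition survivors :: "('a \<Rightarrow> 'a \<Rightarrow> real) \<Rightarrow> (nat \<Rightarrow> 'a) set \<Rightarrow> nat \<Rightarrow> (nat \<Rightarrow> 'a) set" where
  "survivors A H m = {x\<in>SFT A. \<forall>i\<le>m. shift i x \<notin> H}"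

definition compat :: "'a list \<Rightarrow> 'a list \<Rightarrow> bool" where
  "compat X Y \<longleftrightarrow> tl X = butlast Y"

definition star :: "'a list \<Rightarrow> 'a list \<Rightarrow> 'a list" where
  "star X Y = X @ [last Y]"

definition Pblock :: "('a \<Rightarrow> 'a \<Rightarrow> real) \<Rightarrow> ('a \<Rightarrow> 'a \<Rightarrow> real) \<Rightarrow> nat \<Rightarrow> 'a list \<Rightarrow> 'a list \<Rightarrow> real" where
  "Pblock A P n X Y = (if compat X Y \<and> star X Y \<in> Lang A (Suc n) then P (last X) (last Y) else 0)"

(* P_{r-1}, with convention P_0 := P (indexed by words of length 1, identified with symbols) *)
definition Pprev :: "('a \<Rightarrow> 'a \<Rightarrow> real) \<Rightarrow> ('a \<Rightarrow> 'a \<Rightarrow> real) \<Rightarrow> nat \<Rightarrow> 'a list \<Rightarrow> 'a list \<Rightarrow> real" where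
  "Pprev A P r = (if r = 1 then (\<lambda>X Y. P (hd X) (hd Y)) else Pblock A P (r - 1))"

(* Index set of the open-system matrix: L_{r-1} if r >= 2, Sigma (= words of length 1) if r = 1 *)
definition open_index :: "('a \<Rightarrow> 'a \<Rightarrow> real) \<Rightarrow> nat \<Rightarrow> 'a list set" where
  "open_index A r = (if r = 1 then Lang A 1 else Lang A (r - 1))"

definition Bmat :: "('a \<Rightarrow> 'a \<Rightarrow> real) \<Rightarrow> 'a list set \<Rightarrow> nat \<Rightarrow> 'a list \<Rightarrow> 'a list \<Rightarrow> real" where
  "Bmat A G r X Y =
     (if r = 1 then
        (if [hd X, hd Y] \<in> Lang A 2 \<and> [hd X] \<notin> G \<and> [hd Y] \<notin> G then 1 else 0)
      else
        (if compat X Y \<and> star X Y \<in> Lang A r \<and> \<not> (\<exists>w\<in>G. sublist w (star X Y)) then 1 else 0))"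

definition hadamard :: "('i \<Rightarrow> 'j \<Rightarrow> real) \<Rightarrow> ('i \<Rightarrow> 'j \<Rightarrow> real) \<Rightarrow> 'i \<Rightarrow> 'j \<Rightarrow> real" where
  "hadamard M N = (\<lambda>i j. M i j * N i j)"

definition is_eigenvalue :: "'i set \<Rightarrow> ('i \<Rightarrow> 'i \<Rightarrow> real) \<Rightarrow> complex \<Rightarrow> bool" where
  "is_eigenvalue I M z \<longleftrightarrow>
     (\<exists>v :: 'i \<Rightarrow> complex. (\<exists>i\<in>I. v i \<noteq> 0) \<and>
        (\<forall>i\<in>I. (\<Sum>j\<in>I. complex_of_real (M i j) * v j) = z * v i))"

definition spectral_radius :: "'i set \<Rightarrow> ('i \<Rightarrow> 'i \<Rightarrow> real) \<Rightarrow> real" where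
  "spectral_radius I M = Max {cmod z | z. is_eigenvalue I M z}"

definition ln_ereal :: "real \<Rightarrow> ereal" where
  "ln_ereal x = (if x > 0 then ereal (ln x) else - \<infinity>)"

end

theory Submission
  imports "Jordan_Normal_Form.Spectral_Radius" Defs
begin

text \<open>
  A point survives up to time \<open>m\<close> if no word of \<open>G\<close> starts in it at a position \<open>\<le> m\<close>. So, up to
  a bounded change of \<open>m\<close>, the mass of the survivors is the total Markov weight of the words of
  length \<open>m\<close> that avoid \<open>G\<close>. Such words are read off from paths in the graph of the matrix
  \<open>B \<circ> P\<close> on blocks, hence this weight is a positive combination of the row sums of the powers of
  that matrix. An eigenvector of an eigenvalue of maximal modulus bounds some row sum of the \<open>n\<close>-th
  power from below by the \<open>n\<close>-th power of the spectral radius; the Jordan normal form bounds all of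
  them from above by \<open>C t\<^sup>n\<close> for every \<open>t\<close> beyond the spectral radius. The rate is positive because,
  by irreducibility, every word can be continued to one containing a word of \<open>G\<close>, which makes each
  row sum of a sufficiently high power less than 1.

  The case \<open>r = 1\<close> is subsumed: for words of length 1 the matrix in question coincides with the one
  built from windows of length 2.
\<close>

section \<open>Growth of powers of a nonnegative matrix\<close>

text \<open>These are the entries of \<open>Q^n 1\<close>, with \<open>1\<close> the vector of ones:
  \<open>n\<close> steps of the matrix are peeled off from the left, without forming its
  powers.\<close>

fun power_row_sum :: "'i set \<Rightarrow> ('i \<Rightarrow> 'i \<Rightarrow> real) \<Rightarrow> nat \<Rightarrow> 'i \<Rightarrow> real" where
  "power_row_sum I Q 0 i = 1"
| "power_row_sum I Q (Suc n) i = (\<Sum>j\<in>I. Q i j * power_row_sum I Q n j)"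

text \<open>An enumeration of the index set carries \<open>Q\<close> over to the matrix type on
  which the spectrum and the Jordan normal form are available.\<close>

definition enum_mat :: "(nat \<Rightarrow> 'i) \<Rightarrow> nat \<Rightarrow> ('i \<Rightarrow> 'i \<Rightarrow> real) \<Rightarrow> complex Matrix.mat" where
  "enum_mat e n Q = Matrix.mat n n (\<lambda>(i, j). complex_of_real (Q (e i) (e j)))"

lemma enum_mat_carrier: "enum_mat e n Q \<in> carrier_mat n n"
  by (simp add: enum_mat_def)

lemma enum_mat_mult_vec:
  assumes "bij_betw e {..<n} I"
  shows "enum_mat e n Q *\<^sub>v Matrix.vec n (\<lambda>i. v (e i)) =
    Matrix.vec n (\<lambda>i. \<Sum>j\<in>I. complex_of_real (Q (e i) j) * v j)"
proof (rule eq_vecI)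
  fix i assume "i < dim_vec (Matrix.vec n (\<lambda>i. \<Sum>j\<in>I. complex_of_real (Q (e i) j) * v j))"
  then have i: "i < n" by simp
  have "(\<Sum>j\<in>I. complex_of_real (Q (e i) j) * v j) =
      (\<Sum>l\<in>{..<n}. complex_of_real (Q (e i) (e l)) * v (e l))"
    by (rule sum.reindex_bij_betw[OF assms, symmetric])
  then show "vec_index (enum_mat e n Q *\<^sub>v Matrix.vec n (\<lambda>i. v (e i))) i =
      vec_index (Matrix.vec n (\<lambda>i. \<Sum>j\<in>I. complex_of_real (Q (e i) j) * v j)) i"
    using i by (simp add: enum_mat_def scalar_prod_def lessThan_atLeast0)
qed (simp add: enum_mat_def)

lemma eigenvalue_enum_mat:
  assumes e: "bij_betw e {..<n} I"
  shows "eigenvalue (enum_mat e n Q) z \<longleftrightarrow> is_eigenvalue I Q z"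
proof
  assume "eigenvalue (enum_mat e n Q) z"
  then obtain u where u: "u \<in> carrier_vec n" "u \<noteq> 0\<^sub>v n" "enum_mat e n Q *\<^sub>v u = z \<cdot>\<^sub>v u"
    using enum_mat_carrier[of e n Q] by (auto simp: eigenvalue_def eigenvector_def)
  define v where "v j = vec_index u (inv_into {..<n} e j)" for j
  have ve: "v (e i) = vec_index u i" if "i < n" for i
    using e that by (simp add: v_def bij_betw_def inv_into_f_f)
  have u_eq: "u = Matrix.vec n (\<lambda>i. v (e i))"
    using u(1) ve by (intro eq_vecI) auto
  obtain i where i: "i < n" "vec_index u i \<noteq> 0"
    using u(1,2) by (metis carrier_vecD eq_vecI index_zero_vec(1) index_zero_vec(2))
  have vec_eq: "Matrix.vec n (\<lambda>i. \<Sum>j\<in>I. complex_of_real (Q (e i) j) * v j) = z \<cdot>\<^sub>v u"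
    using u(3) enum_mat_mult_vec[OF e, of Q v] u_eq by simp
  have eq: "(\<Sum>j\<in>I. complex_of_real (Q (e i) j) * v j) = z * v (e i)" if "i < n" for i
  proof -
    have "(\<Sum>j\<in>I. complex_of_real (Q (e i) j) * v j) = vec_index (z \<cdot>\<^sub>v u) i"
      using that vec_eq[symmetric] by simp
    then show ?thesis using that u(1) ve by simp
  qed
  have "(\<Sum>j\<in>I. complex_of_real (Q k j) * v j) = z * v k" if "k \<in> I" for k
    using eq e that by (auto simp: bij_betw_def)
  moreover have "e i \<in> I" "v (e i) \<noteq> 0"
    using e i ve by (auto simp: bij_betw_def)
  ultimately show "is_eigenvalue I Q z"
    unfolding is_eigenvalue_def by blast
next
  assume "is_eigenvalue I Q z"
  then obtain v k where v: "k \<in> I" "v k \<noteq> 0"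
    "\<forall>i\<in>I. (\<Sum>j\<in>I. complex_of_real (Q i j) * v j) = z * v i"
    unfolding is_eigenvalue_def by blast
  define u where "u = Matrix.vec n (\<lambda>i. v (e i))"
  obtain i where i: "i < n" "e i = k"
    using v(1) e by (auto simp: bij_betw_def)
  have "u \<noteq> 0\<^sub>v n"
    using i v(2) by (metis index_vec index_zero_vec(1) u_def)
  moreover have "enum_mat e n Q *\<^sub>v u = z \<cdot>\<^sub>v u"
    unfolding u_def enum_mat_mult_vec[OF e]
  proof (rule eq_vecI)
    fix i assume "i < dim_vec (z \<cdot>\<^sub>v Matrix.vec n (\<lambda>i. v (e i)))"
    then have i: "i < n" by simp
    then have "e i \<in> I" using e by (auto simp: bij_betw_def)
    then show "vec_index (Matrix.vec n (\<lambda>i. \<Sum>j\<in>I. complex_of_real (Q (e i) j) * v j)) i =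
        vec_index (z \<cdot>\<^sub>v Matrix.vec n (\<lambda>i. v (e i))) i"
      using i v(3) by simp
  qed simp
  ultimately show "eigenvalue (enum_mat e n Q) z"
    using enum_mat_carrier[of e n Q]
    unfolding eigenvalue_def eigenvector_def by (auto simp: u_def intro!: exI[of _ u])
qed

lemma ex_index_bij:
  assumes "finite I"
  obtains e where "bij_betw e {..<card I} I"
  using ex_bij_betw_nat_finite[OF assms] by (auto simp: lessThan_atLeast0)

text \<open>A square matrix has finitely many eigenvalues; this makes the \<open>Max\<close> in
  \<open>spectral_radius\<close> meaningful.\<close>

lemma finite_eigenvalue_moduli:
  assumes "finite I"
  shows "finite {cmod z | z. is_eigenvalue I Q z}"
proof -
  obtain e where e: "bij_betw e {..<card I} I"
    using ex_index_bij[OF assms] .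
  have "spectrum (enum_mat e (card I) Q) = {z. is_eigenvalue I Q z}"
    by (auto simp: spectrum_def eigenvalue_enum_mat[OF e])
  then have "finite {z. is_eigenvalue I Q z}"
    using card_finite_spectrum(1)[OF enum_mat_carrier] by metis
  then have "finite (cmod ` {z. is_eigenvalue I Q z})" by simp
  then show ?thesis by (simp add: setcompr_eq_image)
qed

lemma cmod_eigenvalue_le_spectral_radius:
  assumes "finite I" "is_eigenvalue I Q z"
  shows "cmod z \<le> spectral_radius I Q"
  unfolding spectral_radius_def using assms finite_eigenvalue_moduli[OF assms(1), of Q]
  by (intro Max_ge) auto

text \<open>Over the complex numbers a matrix of positive size has an eigenvalue, so the maximum is
  taken over a nonempty set.\<close>

lemma spectral_radius_attained:
  assumes "finite I" "I \<noteq> {}"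
  obtains z where "is_eigenvalue I Q z" "cmod z = spectral_radius I Q"
proof -
  obtain e where e: "bij_betw e {..<card I} I"
    using ex_index_bij[OF assms(1)] .
  have "card I > 0"
    using assms by (simp add: card_gt_0_iff)
  then have "spectrum (enum_mat e (card I) Q) \<noteq> {}"
    by (rule spectrum_non_empty[OF enum_mat_carrier])
  then have "{cmod z | z. is_eigenvalue I Q z} \<noteq> {}"
    by (auto simp: spectrum_def eigenvalue_enum_mat[OF e])
  then have "spectral_radius I Q \<in> {cmod z | z. is_eigenvalue I Q z}"
    unfolding spectral_radius_def by (rule Max_in[OF finite_eigenvalue_moduli[OF assms(1)]])
  then show ?thesis using that by auto
qed

section \<open>Comparison of row sums of powers with the spectral radius\<close>

lemma power_row_sum_nonneg:
  assumes "\<And>i j. i \<in> I \<Longrightarrow> j \<in> I \<Longrightarrow> Q i j \<ge> 0" "i \<in> I"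
  shows "power_row_sum I Q n i \<ge> 0"
  using assms(2) by (induction n arbitrary: i) (auto intro!: sum_nonneg mult_nonneg_nonneg assms(1))

text \<open>For an eigenvector \<open>v\<close> whose largest modulus of an entry is
  \<open>V\<close>, nonnegativity of \<open>Q\<close> gives
  \<open>cmod z ^ n * cmod (v i) \<le> power_row_sum I Q n i * V\<close> in every row. A row where
  \<open>V\<close> is attained then serves for all \<open>n\<close> at once.\<close>

lemma cmod_eigenvalue_power_le:
  assumes fin: "finite I" and Q: "\<And>i j. i \<in> I \<Longrightarrow> j \<in> I \<Longrightarrow> Q i j \<ge> 0"
    and z: "is_eigenvalue I Q z"
  obtains i where "i \<in> I" "\<And>n. cmod z ^ n \<le> power_row_sum I Q n i"
proof -
  obtain v k where v: "k \<in> I" "v k \<noteq> 0"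
    "\<And>i. i \<in> I \<Longrightarrow> (\<Sum>j\<in>I. complex_of_real (Q i j) * v j) = z * v i"
    using z unfolding is_eigenvalue_def by blast
  define V where "V = Max ((\<lambda>i. cmod (v i)) ` I)"
  have V: "cmod (v i) \<le> V" if "i \<in> I" for i
    unfolding V_def using that fin by simp
  have "V \<in> (\<lambda>i. cmod (v i)) ` I"
    unfolding V_def using fin v(1) by (intro Max_in) auto
  then obtain i where i: "i \<in> I" "cmod (v i) = V" by auto
  have "V > 0" using V[OF v(1)] v(2) by (smt (verit) zero_less_norm_iff)
  have "cmod z ^ n * cmod (v i) \<le> power_row_sum I Q n i * V" if "i \<in> I" for n i
    using that
  proof (induction n arbitrary: i)
    case 0
    then show ?case using V by simp
  next
    case (Suc n)
    have "cmod z ^ Suc n * cmod (v i) = cmod z ^ n * cmod (\<Sum>j\<in>I. complex_of_real (Q i j) * v j)"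
      using v(3)[OF Suc.prems] by (simp add: norm_mult)
    also have "\<dots> \<le> cmod z ^ n * (\<Sum>j\<in>I. Q i j * cmod (v j))"
      by (intro mult_left_mono order_trans[OF norm_sum] sum_mono)
        (auto simp: norm_mult Q Suc.prems)
    also have "\<dots> = (\<Sum>j\<in>I. Q i j * (cmod z ^ n * cmod (v j)))"
      by (simp add: sum_distrib_left mult_ac)
    also have "\<dots> \<le> (\<Sum>j\<in>I. Q i j * (power_row_sum I Q n j * V))"
      by (intro sum_mono mult_left_mono Suc.IH Q Suc.prems)
    also have "\<dots> = power_row_sum I Q (Suc n) i * V"
      by (simp add: sum_distrib_right mult.assoc)
    finally show ?case .
  qed
  from this[OF i(1)] \<open>V > 0\<close> i have "cmod z ^ n \<le> power_row_sum I Q n i" for n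
    by simp
  with i(1) show ?thesis using that by blast
qed

lemma is_eigenvalue_scale:
  assumes "t \<noteq> 0"
  shows "is_eigenvalue I (\<lambda>i j. Q i j / t) z \<longleftrightarrow> is_eigenvalue I Q (complex_of_real t * z)"
proof -
  have "(\<Sum>j\<in>I. complex_of_real (Q i j / t) * v j) = z * v i \<longleftrightarrow>
      (\<Sum>j\<in>I. complex_of_real (Q i j) * v j) = complex_of_real t * z * v i" for v i
  proof -
    have "(\<Sum>j\<in>I. complex_of_real (Q i j / t) * v j) =
        (\<Sum>j\<in>I. complex_of_real (Q i j) * v j) / complex_of_real t"
      by (simp add: sum_divide_distrib)
    moreover have "S / complex_of_real t = w \<longleftrightarrow> S = complex_of_real t * w" for S w
      using assms by (auto simp: field_simps)
    ultimately show ?thesis by (simp add: mult.assoc)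
  qed
  then show ?thesis unfolding is_eigenvalue_def by simp
qed

text \<open>The eigenvalues of \<open>Q / t\<close> lie inside the open unit disc, so by the Jordan
  normal form one constant \<open>c\<close> bounds all entries of all its powers. Summing a row and
  scaling back yields \<open>C = real N * c\<close>.\<close>

lemma power_row_sum_bound:
  assumes fin: "finite I" "I \<noteq> {}" and t: "t > 0" "t > spectral_radius I Q"
  obtains C where "\<And>n i. i \<in> I \<Longrightarrow> power_row_sum I Q n i \<le> C * t ^ n"
proof -
  define N where "N = card I"
  obtain e where e: "bij_betw e {..<N} I"
    using ex_index_bij[OF fin(1)] unfolding N_def .
  define K where "K = enum_mat e N (\<lambda>i j. Q i j / t)"
  have K: "K \<in> carrier_mat N N" unfolding K_def by (rule enum_mat_carrier)
  have Kk: "K ^\<^sub>m k \<in> carrier_mat N N" for k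
    using K by (rule pow_carrier_mat)
  have "N > 0" using fin by (simp add: N_def card_gt_0_iff)
  have "cmod z < 1" if "eigenvalue K z" for z
  proof -
    have "is_eigenvalue I Q (complex_of_real t * z)"
      using that t is_eigenvalue_scale[of t I Q z] by (simp add: K_def eigenvalue_enum_mat[OF e])
    from cmod_eigenvalue_le_spectral_radius[OF fin(1) this] t show ?thesis
      by (simp add: norm_mult) (smt (verit) mult_less_cancel_left2)
  qed
  then have "Spectral_Radius.spectral_radius K < 1"
    using spectral_radius_mem_max(1)[OF K \<open>N > 0\<close>] by (auto simp: spectrum_def)
  then obtain c where c: "\<And>k. norm_bound (K ^\<^sub>m k) c"
    using spectral_radius_jnf_norm_bound_less_1_upper_triangular[OF K] by blast
  \<comment> \<open>Row sums scaled by \<open>t ^ j\<close>: the matrix \<open>K\<close> takes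
    \<open>r j\<close> to \<open>r (Suc j)\<close>, and \<open>r 0\<close> is the vector of
    ones.\<close>
  define R where "R j i = complex_of_real (power_row_sum I Q j i / t ^ j)" for i j
  define r where "r j = Matrix.vec N (\<lambda>i. R j (e i))" for j
  have r: "r j \<in> carrier_vec N" for j by (simp add: r_def)
  have step: "K *\<^sub>v r j = r (Suc j)" for j
    unfolding K_def r_def enum_mat_mult_vec[OF e]
    by (rule eq_vecI) (simp_all add: R_def sum_divide_distrib sum_distrib_left mult_ac)
  have pow: "K ^\<^sub>m k *\<^sub>v r j = r (k + j)" for k j
  proof (induction k arbitrary: j)
    case 0
    then show ?case using K r by simp
  next
    case (Suc k)
    have "K ^\<^sub>m Suc k *\<^sub>v r j = K ^\<^sub>m k *\<^sub>v (K *\<^sub>v r j)"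
      using assoc_mult_mat_vec[OF Kk K r] by simp
    then show ?case using step Suc.IH[of "Suc j"] by simp
  qed
  have "power_row_sum I Q k i \<le> real N * c * t ^ k" if "i \<in> I" for k i
  proof -
    obtain a where a: "a < N" "e a = i"
      using \<open>i \<in> I\<close> e unfolding bij_betw_def by blast
    have "R k i = vec_index (K ^\<^sub>m k *\<^sub>v r 0) a"
      using pow[of k 0] a by (simp add: r_def)
    also have "\<dots> = (\<Sum>b<N. (K ^\<^sub>m k) $$ (a, b))"
      using a Kk[of k] K by (simp add: scalar_prod_def r_def R_def lessThan_atLeast0)
    finally have "cmod (R k i) \<le> (\<Sum>b<N. cmod ((K ^\<^sub>m k) $$ (a, b)))"
      by (simp add: norm_sum)
    also have "\<dots> \<le> (\<Sum>b<N. c)"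
      using c[of k] pow_mat_dim_square[OF K, of k] a(1)
      by (intro sum_mono) (auto simp: norm_bound_def simp del: pow_mat_dim)
    finally have "\<bar>power_row_sum I Q k i / t ^ k\<bar> \<le> real N * c"
      by (simp add: R_def del: of_real_divide of_real_power)
    then have "power_row_sum I Q k i / t ^ k \<le> real N * c" by linarith
    then show ?thesis using t(1) by (simp add: field_simps)
  qed
  then show ?thesis using that by blast
qed

lemma spectral_radius_cong:
  assumes "\<And>i j. i \<in> I \<Longrightarrow> j \<in> I \<Longrightarrow> Q i j = Q' i j"
  shows "spectral_radius I Q = spectral_radius I Q'"
proof -
  have "(\<Sum>j\<in>I. complex_of_real (Q i j) * v j) = (\<Sum>j\<in>I. complex_of_real (Q' i j) * v j)"
    if "i \<in> I" for i v
    using assms that by (intro sum.cong) simp_all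
  then show ?thesis by (simp add: spectral_radius_def is_eigenvalue_def)
qed

section \<open>Exponential rates\<close>

text \<open>The lower bound keeps the limit superior at or below \<open>- ln_ereal \<rho>\<close>;
  the upper bound keeps the limit inferior at or above \<open>- ln t\<close> for each
  \<open>t > \<rho>\<close>, and \<open>t\<close> tends to \<open>\<rho>\<close>. This form includes
  \<open>\<rho> = 0\<close>, where the rate is infinite.\<close>

lemma escape_rate_limit:
  fixes a :: "nat \<Rightarrow> real" and \<rho> c :: real
  assumes "\<rho> \<ge> 0" "c > 0" and lower: "\<And>m. c * \<rho> ^ Suc m \<le> a m"
    and upper: "\<And>t. 0 < t \<Longrightarrow> \<rho> < t \<Longrightarrow> \<exists>C. \<forall>\<^sub>F m in sequentially. a m \<le> C * t ^ m"
  shows "(\<lambda>m. - ln_ereal (a m) / ereal (real m)) \<longlonglongrightarrow> - ln_ereal \<rho>"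
proof (rule order_tendstoI)
  fix l assume "l < - ln_ereal \<rho>"
  then obtain y where y: "l < ereal y" "ereal y < - ln_ereal \<rho>"
    using ereal_dense2 by blast
  \<comment> \<open>The number \<open>exp (- y')\<close> will serve as \<open>t\<close>; the gap
    between \<open>y\<close> and \<open>y'\<close> absorbs the vanishing term
    \<open>- ln C / real m\<close>.\<close>
  then obtain y' where y': "ereal y < ereal y'" "ereal y' < - ln_ereal \<rho>"
    using ereal_dense2 by blast
  have "\<rho> < exp (- y')"
  proof (cases "\<rho> > 0")
    case True
    then have "ln \<rho> < - y'" using y'(2) by (simp add: ln_ereal_def)
    then show ?thesis using True by (metis exp_less_mono exp_ln)
  next
    case False
    then show ?thesis by (smt (verit) exp_gt_zero)
  qed
  then obtain C where C: "\<forall>\<^sub>F m in sequentially. a m \<le> C * exp (- y') ^ m"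
    using upper[of "exp (- y')"] by auto
  have "(\<lambda>m. - ln C / real m + y') \<longlonglongrightarrow> 0 + y'"
    by (intro tendsto_intros lim_const_over_n)
  then have "\<forall>\<^sub>F m in sequentially. - ln C / real m + y' > y"
    using y'(1) by (intro order_tendstoD(1)[of _ y']) auto
  with C eventually_gt_at_top[of 0]
  show "\<forall>\<^sub>F m in sequentially. l < - ln_ereal (a m) / ereal (real m)"
  proof eventually_elim
    case (elim m)
    show ?case
    proof (cases "a m > 0")
      case True
      then have "0 < C * exp (- y') ^ m" using elim(1) by linarith
      then have C0: "C > 0" by (simp add: zero_less_mult_iff)
      have "ln (a m) \<le> ln (C * exp (- y') ^ m)"
        using True elim(1) by simp
      also have "\<dots> = ln C - real m * y'"
        using C0 by (simp add: ln_mult ln_realpow)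
      finally have "(- ln C + real m * y') / real m \<le> - ln (a m) / real m"
        by (intro divide_right_mono) simp_all
      then have "- ln C / real m + y' \<le> - ln (a m) / real m"
        using elim(2) by (simp add: diff_divide_distrib)
      with elim(3) have "ereal y < ereal (- ln (a m) / real m)" by simp
      also have "\<dots> = - ln_ereal (a m) / ereal (real m)"
        using True elim(2) by (simp add: ln_ereal_def)
      finally show ?thesis using y(1) by (rule less_trans[rotated])
    next
      case False
      then have "- ln_ereal (a m) / ereal (real m) = \<infinity>"
        using elim(2) by (simp add: ln_ereal_def)
      then show ?thesis using y(1) by (metis ereal_less(4) ereal_infty_less(1) less_ereal.simps(4) not_less_iff_gr_or_eq)
    qed
  qed
next
  fix l assume l: "- ln_ereal \<rho> < l"
  \<comment> \<open>For \<open>\<rho> = 0\<close> the limit is \<infinity>, which no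
    \<open>l\<close> exceeds.\<close>
  then have pos: "\<rho> > 0" by (cases "\<rho> > 0") (auto simp: ln_ereal_def)
  \<comment> \<open>The exponent \<open>Suc m\<close> in the lower bound turns the constant
    \<open>c\<close> into \<open>c * \<rho>\<close>.\<close>
  define g where "g m = - ln (c * \<rho>) / real m - ln \<rho>" for m
  have "(\<lambda>m. g m) \<longlonglongrightarrow> 0 - ln \<rho>"
    unfolding g_def by (intro tendsto_intros lim_const_over_n)
  then have "(\<lambda>m. ereal (g m)) \<longlonglongrightarrow> - ln_ereal \<rho>"
    using pos by (simp add: ln_ereal_def)
  then have "\<forall>\<^sub>F m in sequentially. ereal (g m) < l"
    using l by (rule order_tendstoD(2))
  with eventually_gt_at_top[of 0]
  show "\<forall>\<^sub>F m in sequentially. - ln_ereal (a m) / ereal (real m) < l"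
  proof eventually_elim
    case (elim m)
    have c0: "c * \<rho> > 0" using assms(2) pos by simp
    then have "0 < c * \<rho> * \<rho> ^ m" using pos by simp
    moreover have le: "c * \<rho> * \<rho> ^ m \<le> a m" using lower[of m] by (simp add: mult.assoc)
    ultimately have a0: "a m > 0" and "ln (c * \<rho> * \<rho> ^ m) \<le> ln (a m)"
      by simp_all
    moreover have "ln (c * \<rho> * \<rho> ^ m) = ln (c * \<rho>) + real m * ln \<rho>"
      using c0 pos ln_mult_pos[of "c * \<rho>" "\<rho> ^ m"] by (simp add: ln_realpow)
    ultimately have "- ln (a m) / real m \<le> (- ln (c * \<rho>) - real m * ln \<rho>) / real m"
      by (intro divide_right_mono) simp_all
    also have "\<dots> = g m"
      using elim(1) by (simp add: g_def diff_divide_distrib)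
    finally have "- ln (a m) / real m \<le> g m" .
    then have "- ln_ereal (a m) / ereal (real m) \<le> ereal (g m)"
      using a0 elim(1) by (simp add: ln_ereal_def)
    then show ?case using elim(2) by (rule le_less_trans)
  qed
qed

section \<open>Markov measures on a subshift of finite type\<close>

locale markov_sft =
  fixes A P :: "'a::finite \<Rightarrow> 'a \<Rightarrow> real" and p :: "'a \<Rightarrow> real"
  assumes A01: "A i j = 0 \<or> A i j = 1"
    and A_irr: "irreducible_mat A"
    and P_nonneg: "P i j \<ge> 0"
    and P_stoch: "(\<Sum>j\<in>UNIV. P i j) = 1"
    and P_compat: "P i j > 0 \<longleftrightarrow> A i j = 1"
    and p_stat: "(\<Sum>i\<in>UNIV. p i * P i j) = p j"
    and p_sum: "(\<Sum>i\<in>UNIV. p i) = 1"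
begin

section \<open>Allowed words as paths in a strongly connected graph\<close>

abbreviation edge :: "'a \<Rightarrow> 'a \<Rightarrow> bool" where
  "edge i j \<equiv> A i j = 1"

lemma P_eq_0_iff: "P i j = 0 \<longleftrightarrow> \<not> edge i j"
  using P_compat[of i j] P_nonneg[of i j] by linarith

lemma ex_edge: "\<exists>j. edge i j"
proof (rule ccontr)
  assume "\<not> (\<exists>j. edge i j)"
  then have "P i j = 0" for j by (simp add: P_eq_0_iff)
  then show False using P_stoch[of i] by simp
qed

lemma mpow_pos_imp_rtranclp: "mpow A n i j > 0 \<Longrightarrow> edge\<^sup>*\<^sup>* i j"
proof (induction n arbitrary: j)
  case 0
  then show ?case by (simp split: if_splits)
next
  case (Suc n)
  then obtain k where k: "mpow A n i k * A k j > 0"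
    by (metis (no_types, lifting) mpow.simps(2) not_less sum_nonpos)
  then have "edge k j" using A01[of k j] by auto
  moreover have "mpow A n i k > 0" using k \<open>edge k j\<close> by simp
  ultimately show ?case using Suc.IH[of k] by (simp add: rtranclp.rtrancl_into_rtrancl)
qed

lemma edge_rtranclp: "edge\<^sup>*\<^sup>* i j"
  using A_irr mpow_pos_imp_rtranclp unfolding irreducible_mat_def by blast

lemma ex_path: "\<exists>u. successively edge (i # u) \<and> last (i # u) = j"
  using edge_rtranclp[of i j]
proof (induction rule: rtranclp_induct)
  case base
  show ?case by (rule exI[of _ "[]"]) simp
next
  case (step k l)
  then obtain u where "successively edge (i # u)" "last (i # u) = k" by blast
  then have "successively edge ((i # u) @ [l])" "last ((i # u) @ [l]) = l"
    using step(2) by (simp_all only: successively_append_iff) auto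
  then show ?case by (intro exI[of _ "u @ [l]"]) simp
qed

text \<open>Every letter has a successor, so a path is prolonged forever by iterating a choice
  \<open>s\<close> of successors from its last letter.\<close>

lemma ex_SFT_extension:
  assumes "successively edge w" "w \<noteq> []"
  shows "\<exists>x\<in>SFT A. w = map x [0..<length w]"
proof -
  define s where "s i = (SOME j. edge i j)" for i
  have s: "edge i (s i)" for i
    unfolding s_def using ex_edge by (rule someI_ex)
  \<comment> \<open>The exponent is 1 at position \<open>length w\<close>, the first new
    letter.\<close>
  define x where "x n = (if n < length w then w ! n else (s ^^ (Suc n - length w)) (last w))" for n
  have "edge (x n) (x (Suc n))" for n
  proof -
    consider "Suc n < length w" | "Suc n = length w" | "length w \<le> n" by linarith
    then show ?thesis
    proof cases
      case 1
      then show ?thesis using successively_nth[OF assms(1)] by (simp add: x_def)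
    next
      case 2
      then have "n = length w - 1" by simp
      then have "x n = last w" using assms(2) by (simp add: x_def last_conv_nth)
      moreover have "x (Suc n) = s (last w)" unfolding x_def 2 by simp
      ultimately show ?thesis using s by simp
    next
      case 3
      then show ?thesis using s by (simp add: x_def Suc_diff_le)
    qed
  qed
  moreover have "w = map x [0..<length w]"
    by (rule nth_equalityI) (simp_all add: x_def)
  ultimately show ?thesis by (auto simp: SFT_def)
qed

text \<open>Paths extend to sequences, so being allowed becomes a condition on consecutive letters
  only.\<close>

lemma allowed_iff: "allowed A w \<longleftrightarrow> successively edge w"
proof
  assume "allowed A w"
  then obtain x k where x: "x \<in> SFT A" "w = map x [k..<k + length w]"
    unfolding allowed_def by blast
  have "w ! i = x (k + i)" if "i < length w" for i
    using that by (subst x(2)) simp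
  then show "successively edge w"
    using x(1) by (auto simp: successively_conv_nth SFT_def)
next
  assume w: "successively edge w"
  show "allowed A w"
  proof (cases "w = []")
    case True
    obtain x where "x \<in> SFT A" using ex_SFT_extension[of "[undefined]"] by auto
    then show ?thesis using True unfolding allowed_def by auto
  next
    case False
    then show ?thesis
      using ex_SFT_extension[OF w] unfolding allowed_def by (metis add_0)
  qed
qed

lemma Lang_iff: "w \<in> Lang A n \<longleftrightarrow> length w = n \<and> successively edge w"
  by (simp add: Lang_def allowed_iff)

lemma finite_Lang: "finite (Lang A n)"
  by (rule finite_subset[OF _ finite_lists_length_eq[of UNIV n]]) (auto simp: Lang_def)

lemma SFT_prefix_in_Lang: "x \<in> SFT A \<Longrightarrow> map x [0..<n] \<in> Lang A n"
  by (auto simp: Lang_def allowed_def intro!: bexI[of _ x] exI[of _ 0])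

lemma Lang_nonempty: "Lang A n \<noteq> {}"
proof -
  obtain x where "x \<in> SFT A" using ex_SFT_extension[of "[undefined]"] by auto
  then show ?thesis using SFT_prefix_in_Lang by blast
qed

text \<open>A priori \<open>p\<close> may have entries of either sign. Stochasticity makes \<open>\<bar>p\<bar>\<close> stationary as
  well, and then irreducibility forces the nonnegative stationary vector \<open>p + \<bar>p\<bar>\<close> to be
  positive everywhere, as it is positive somewhere.\<close>

lemma p_pos: "p i > 0"
proof -
  have le: "\<bar>p j\<bar> \<le> (\<Sum>i\<in>UNIV. \<bar>p i\<bar> * P i j)" for j
    using sum_abs[of "\<lambda>i. p i * P i j" UNIV] by (simp add: p_stat abs_mult P_nonneg)
  have "(\<Sum>j\<in>UNIV. \<Sum>i\<in>UNIV. \<bar>p i\<bar> * P i j) = (\<Sum>i\<in>UNIV. \<Sum>j\<in>UNIV. \<bar>p i\<bar> * P i j)"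
    by (rule sum.swap)
  also have "\<dots> = (\<Sum>i\<in>UNIV. \<bar>p i\<bar>)"
    by (simp add: P_stoch flip: sum_distrib_left)
  finally have "(\<Sum>j\<in>UNIV. (\<Sum>i\<in>UNIV. \<bar>p i\<bar> * P i j) - \<bar>p j\<bar>) = 0"
    by (simp add: sum_subtractf)
  then have abs_stat: "(\<Sum>i\<in>UNIV. \<bar>p i\<bar> * P i j) = \<bar>p j\<bar>" for j
    using le by (subst (asm) sum_nonneg_eq_0_iff) auto
  define q where "q j = p j + \<bar>p j\<bar>" for j
  have q0: "q j \<ge> 0" for j by (simp add: q_def)
  have q_stat: "(\<Sum>i\<in>UNIV. q i * P i j) = q j" for j
    by (simp add: q_def distrib_right sum.distrib p_stat abs_stat)
  have "\<exists>k. p k > 0"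
  proof (rule ccontr)
    assume "\<not> (\<exists>k. p k > 0)"
    then have "(\<Sum>i\<in>UNIV. p i) \<le> 0" by (intro sum_nonpos) (simp add: not_less)
    then show False using p_sum by simp
  qed
  then obtain k where "p k > 0" ..
  then have "q k > 0" by (simp add: q_def)
  have "q i > 0"
    using edge_rtranclp[of k i]
  proof (induction rule: rtranclp_induct)
    case base
    show ?case by fact
  next
    case (step a b)
    have "0 < q a * P a b" using step P_compat[of a b] by simp
    also have "\<dots> \<le> (\<Sum>i\<in>UNIV. q i * P i b)"
      by (rule member_le_sum) (simp_all add: q0 P_nonneg)
    finally show ?case by (simp add: q_stat)
  qed
  then show ?thesis by (simp add: q_def split: abs_split)
qed

section \<open>Markov weights of words and events determined by a prefix\<close>

lemma markov_cyl_snoc: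
  assumes "w \<noteq> []"
  shows "markov_cyl P p (w @ [y]) = markov_cyl P p w * P (last w) y"
proof -
  obtain n where n: "length w = Suc n" using assms by (cases w) auto
  have "(\<Prod>i<n. P ((w @ [y]) ! i) ((w @ [y]) ! Suc i)) = (\<Prod>i<n. P (w ! i) (w ! Suc i))"
    using n by (intro prod.cong) (auto simp: nth_append)
  moreover have "(w @ [y]) ! n = last w" "(w @ [y]) ! Suc n = y"
    using n assms by (simp_all add: nth_append last_conv_nth)
  ultimately show ?thesis
    using n assms by (simp add: markov_cyl_def)
qed

lemma markov_cyl_pos:
  assumes "successively edge w"
  shows "markov_cyl P p w > 0"
  unfolding markov_cyl_def using assms p_pos P_compat
  by (intro mult_pos_pos prod_pos) (auto simp: successively_conv_nth)

text \<open>An event depending on the first \<open>n\<close> letters is a finite disjoint union of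
  cylinders of words of length \<open>n\<close>. The length is positive because \<open>M_cyl\<close>
  prescribes the mass of cylinders of nonempty words.\<close>

lemma prefix_event:
  fixes M :: "(nat \<Rightarrow> 'a) measure" and \<phi> :: "'a list \<Rightarrow> bool"
  assumes M_sets: "sets M = sigma_sets (SFT A) {cyl A w | w. allowed A w}"
    and M_cyl: "\<forall>w. allowed A w \<and> w \<noteq> [] \<longrightarrow> emeasure M (cyl A w) = ennreal (markov_cyl P p w)"
    and n: "n > 0"
  defines "E \<equiv> {x \<in> SFT A. \<phi> (map x [0..<n])}"
  shows "E \<in> sets M" "emeasure M E = ennreal (\<Sum>w | w \<in> Lang A n \<and> \<phi> w. markov_cyl P p w)"
proof -
  let ?S = "{w \<in> Lang A n. \<phi> w}"
  have fin: "finite ?S" using finite_Lang by simp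
  have cyl_eq: "cyl A w = {x \<in> SFT A. map x [0..<n] = w}" if "w \<in> ?S" for w
    using that by (auto simp: cyl_def Lang_def list_eq_iff_nth_eq)
  have E: "E = (\<Union>w\<in>?S. cyl A w)"
    using SFT_prefix_in_Lang[of _ n] by (auto simp: E_def cyl_eq)
  have sets: "cyl A w \<in> sets M" if "w \<in> ?S" for w
    using that unfolding M_sets by (intro sigma_sets.Basic) (auto simp: Lang_def)
  show "E \<in> sets M"
    unfolding E using fin sets by (intro sets.finite_UN)
  have "disjoint_family_on (cyl A) ?S"
    unfolding disjoint_family_on_def using cyl_eq by auto
  then have "emeasure M E = (\<Sum>w\<in>?S. emeasure M (cyl A w))"
    unfolding E using fin sets by (intro sum_emeasure[symmetric]) auto
  also have "\<dots> = (\<Sum>w\<in>?S. ennreal (markov_cyl P p w))"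
    using n M_cyl by (intro sum.cong refl) (auto simp: Lang_def)
  also have "\<dots> = ennreal (\<Sum>w\<in>?S. markov_cyl P p w)"
    using markov_cyl_pos by (intro sum_ennreal) (auto simp: Lang_iff less_imp_le)
  finally show "emeasure M E = ennreal (\<Sum>w | w \<in> Lang A n \<and> \<phi> w. markov_cyl P p w)" .
qed

end

section \<open>The open system\<close>

text \<open>The block length \<open>d\<close> will be \<open>r - 1\<close> for \<open>r > 1\<close>
  and 1 for \<open>r = 1\<close>. Both choices satisfy the bound \<open>Suc d\<close> on the lengths
  in \<open>G\<close>, so one argument covers both.\<close>

locale open_markov_sft = markov_sft A P p
  for A P :: "'a::finite \<Rightarrow> 'a \<Rightarrow> real" and p :: "'a \<Rightarrow> real" +
  fixes G :: "'a list set" and d :: nat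
  assumes G_nonempty: "G \<noteq> {}"
    and G_allowed: "u \<in> G \<Longrightarrow> allowed A u \<and> u \<noteq> []"
    and G_length: "u \<in> G \<Longrightarrow> length u \<le> Suc d"
    and d_pos: "d > 0"
begin

definition avoids :: "'a list \<Rightarrow> bool" where
  "avoids w \<longleftrightarrow> \<not> (\<exists>u\<in>G. sublist u w)"

text \<open>The Hadamard product of the adjacency matrix of the open system with the block
  transition matrix, in one formula for all \<open>r\<close>.\<close>

definition open_mat :: "'a list \<Rightarrow> 'a list \<Rightarrow> real" where
  "open_mat X Y = (if tl X = butlast Y \<and> X @ [last Y] \<in> Lang A (Suc d) \<and> avoids (X @ [last Y])
     then P (last X) (last Y) else 0)"

abbreviation "row_mass \<equiv> power_row_sum (Lang A d) open_mat"

section \<open>Row sums of the powers of the open matrix\<close>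

lemma open_mat_nonneg: "open_mat X Y \<ge> 0"
  by (simp add: open_mat_def P_nonneg)

lemma Lang_snoc_iff: "n > 0 \<Longrightarrow> X @ [y] \<in> Lang A (Suc n) \<longleftrightarrow> X \<in> Lang A n \<and> edge (last X) y"
  by (auto simp: Lang_iff successively_append_iff)

lemma Lang_tl_snoc:
  assumes "X \<in> Lang A n" "n > 0" "edge (last X) y"
  shows "tl X @ [y] \<in> Lang A n"
proof -
  have "X @ [y] \<in> Lang A (Suc n)" using assms by (simp add: Lang_snoc_iff)
  moreover obtain a X' where X: "X = a # X'" using assms by (cases X) (auto simp: Lang_def)
  ultimately show ?thesis
    by (cases "X' @ [y]") (auto simp: Lang_iff)
qed

text \<open>A nonzero entry in row \<open>X\<close> has its column of the form
  \<open>tl X @ [y]\<close>, so a sum over blocks becomes a sum over the appended letter. Letters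
  that are not successors contribute 0 through \<open>P\<close>.\<close>

lemma sum_open_mat:
  assumes X: "X \<in> Lang A d"
  shows "(\<Sum>Y\<in>Lang A d. open_mat X Y * g Y) =
    (\<Sum>y\<in>UNIV. if avoids (X @ [y]) then P (last X) y * g (tl X @ [y]) else 0)"
proof -
  let ?h = "\<lambda>y. if avoids (X @ [y]) then P (last X) y * g (tl X @ [y]) else 0"
  let ?S = "{Y \<in> Lang A d. open_mat X Y \<noteq> 0}"
  let ?T = "{y. avoids (X @ [y]) \<and> edge (last X) y}"
  have "(\<Sum>Y\<in>Lang A d. open_mat X Y * g Y) = (\<Sum>Y\<in>?S. open_mat X Y * g Y)"
    by (rule sum.mono_neutral_right) (auto simp: finite_Lang)
  also have "\<dots> = (\<Sum>y\<in>?T. ?h y)"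
  proof (rule sum.reindex_bij_witness[of _ "\<lambda>y. tl X @ [y]" last])
    fix Y assume "Y \<in> ?S"
    then have Y: "Y \<in> Lang A d" "tl X = butlast Y" "X @ [last Y] \<in> Lang A (Suc d)"
        "avoids (X @ [last Y])"
      by (auto simp: open_mat_def split: if_splits)
    then have "Y \<noteq> []" using d_pos by (auto simp: Lang_def)
    then show eq: "tl X @ [last Y] = Y" using Y by simp
    show "last Y \<in> ?T"
      using Y d_pos by (simp add: Lang_snoc_iff)
    show "?h (last Y) = open_mat X Y * g Y"
      using Y eq by (simp add: open_mat_def)
  next
    fix y assume y: "y \<in> ?T"
    then have "open_mat X (tl X @ [y]) \<noteq> 0"
      using X d_pos by (simp add: open_mat_def Lang_snoc_iff P_eq_0_iff)
    then show "tl X @ [y] \<in> ?S"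
      using X y d_pos by (simp add: Lang_tl_snoc)
  qed simp
  also have "\<dots> = (\<Sum>y\<in>UNIV. ?h y)"
    by (rule sum.mono_neutral_left) (auto simp: P_eq_0_iff)
  finally show ?thesis .
qed

lemma row_mass_Suc:
  "X \<in> Lang A d \<Longrightarrow> row_mass (Suc n) X =
    (\<Sum>y\<in>UNIV. if avoids (X @ [y]) then P (last X) y * row_mass n (tl X @ [y]) else 0)"
  by (simp add: sum_open_mat)

lemma row_mass_nonneg: "X \<in> Lang A d \<Longrightarrow> row_mass n X \<ge> 0"
  by (rule power_row_sum_nonneg) (simp_all add: open_mat_nonneg)

text \<open>Termwise comparison with a row of \<open>P\<close>, whose sum is 1. If \<open>y\<close>
  is no successor, \<open>tl X @ [y]\<close> need not be allowed, but both sides vanish.\<close>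

lemma row_mass_summand_le:
  assumes X: "X \<in> Lang A d" and le: "\<And>Y. Y \<in> Lang A d \<Longrightarrow> row_mass n Y \<le> 1"
  shows "(if avoids (X @ [y]) then P (last X) y * row_mass n (tl X @ [y]) else 0) \<le> P (last X) y"
proof (cases "edge (last X) y")
  case True
  then show ?thesis
    using le[OF Lang_tl_snoc[OF X d_pos True]] P_nonneg[of "last X" y]
    by (simp add: mult_left_le)
next
  case False
  then show ?thesis by (simp flip: P_eq_0_iff)
qed

lemma row_mass_le_1: "X \<in> Lang A d \<Longrightarrow> row_mass n X \<le> 1"
proof (induction n arbitrary: X)
  case (Suc n)
  have "row_mass (Suc n) X \<le> (\<Sum>y\<in>UNIV. P (last X) y)"
    unfolding row_mass_Suc[OF Suc.prems] by (intro sum_mono row_mass_summand_le Suc)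
  then show ?case by (simp add: P_stoch)
qed simp

lemma row_mass_Suc_less_1:
  assumes X: "X \<in> Lang A d" and y: "edge (last X) y"
    and less: "\<not> avoids (X @ [y]) \<or> row_mass n (tl X @ [y]) < 1"
  shows "row_mass (Suc n) X < 1"
proof -
  have "P (last X) y > 0" using y P_compat by blast
  then have "(if avoids (X @ [y]) then P (last X) y * row_mass n (tl X @ [y]) else 0) < P (last X) y"
    using less by auto
  then have ex: "\<exists>y\<in>UNIV. (if avoids (X @ [y]) then P (last X) y * row_mass n (tl X @ [y]) else 0) < P (last X) y"
    by (rule bexI) simp
  have "row_mass (Suc n) X < (\<Sum>y\<in>UNIV. P (last X) y)"
    unfolding row_mass_Suc[OF X]
    by (rule sum_strict_mono_ex1[OF finite ballI ex]) (rule row_mass_summand_le[OF X row_mass_le_1])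
  then show ?thesis by (simp add: P_stoch)
qed

text \<open>The window slides along \<open>v\<close> one letter at a time. Either the current window
  of length \<open>Suc d\<close> contains a word of \<open>G\<close>, and mass is lost at this step,
  or the occurrence of \<open>u\<close> survives the removal of the first letter.\<close>

lemma row_mass_less_1_of_word:
  assumes "X \<in> Lang A d" "successively edge (X @ v)" "v \<noteq> []" "u \<in> G" "sublist u (X @ v)"
  shows "row_mass (length v) X < 1"
  using assms
proof (induction v arbitrary: X)
  case (Cons y v)
  have y: "edge (last X) y"
    using Cons.prems(1,2) d_pos by (auto simp: successively_append_iff Lang_def)
  show ?case
  proof (cases "avoids (X @ [y])")
    case False
    then show ?thesis using row_mass_Suc_less_1[OF Cons.prems(1) y] by simp
  next
    case True
    obtain a X' where X: "X = a # X'"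
      using Cons.prems(1) d_pos by (cases X) (auto simp: Lang_def)
    have no: "\<not> sublist u (X @ [y])" using True Cons.prems(4) by (auto simp: avoids_def)
    \<comment> \<open>An occurrence at the very start would fit into the window, as \<open>u\<close>
      has length at most \<open>Suc d\<close>.\<close>
    have "\<not> prefix u (X @ y # v)"
    proof
      assume "prefix u (X @ y # v)"
      moreover have "prefix (X @ [y]) (X @ y # v)" by simp
      moreover have "length u \<le> length (X @ [y])"
        using G_length[OF Cons.prems(4)] Cons.prems(1) by (simp add: Lang_def)
      ultimately have "prefix u (X @ [y])" by (rule prefix_length_prefix)
      then show False using no by (simp add: prefix_imp_sublist)
    qed
    then have sub: "sublist u ((tl X @ [y]) @ v)"
      using Cons.prems(5) by (simp add: X sublist_Cons_right)
    have "v \<noteq> []"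
    proof
      assume "v = []"
      then show False using Cons.prems(5) no by simp
    qed
    moreover have "successively edge ((tl X @ [y]) @ v)"
      using Cons.prems(2) by (cases "X' @ y # v") (auto simp: X)
    ultimately have "row_mass (length v) (tl X @ [y]) < 1"
      using Cons.IH[OF Lang_tl_snoc[OF Cons.prems(1) d_pos y]] sub Cons.prems(4) by blast
    then show ?thesis using row_mass_Suc_less_1[OF Cons.prems(1) y] by simp
  qed
qed simp

text \<open>By irreducibility \<open>X\<close> can be continued to the first letter of some
  \<open>u\<close> in \<open>G\<close> and then along the rest of \<open>u\<close>.\<close>

lemma ex_row_mass_less_1:
  assumes X: "X \<in> Lang A d"
  shows "\<exists>n. row_mass n X < 1"
proof -
  obtain u where u: "u \<in> G" using G_nonempty by blast
  obtain a u' where u': "u = a # u'" using G_allowed[OF u] by (cases u) auto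
  \<comment> \<open>The extra edge makes the continuation nonempty even if the path found next is
    trivial.\<close>
  obtain b where b: "edge (last X) b" using ex_edge by blast
  obtain v where v: "successively edge (b # v)" "last (b # v) = a"
    using ex_path by blast
  have X0: "X \<noteq> []" "successively edge X" using X d_pos by (auto simp: Lang_iff)
  have "(b # v) = butlast (b # v) @ [a]" using v(2) by (metis append_butlast_last_id list.distinct(1))
  then have "sublist u (X @ (b # v) @ u')"
    unfolding u' by (metis append.assoc append_Cons append_Nil sublist_append_leftI)
  moreover have "successively edge ((b # v) @ u')"
    using v G_allowed[OF u] unfolding allowed_iff u'
    by (subst successively_append_iff) (cases u'; simp)
  then have "successively edge (X @ (b # v) @ u')"
    using X0 b by (subst successively_append_iff) simp
  ultimately show ?thesis
    using row_mass_less_1_of_word[OF X _ _ u, of "(b # v) @ u'"] by blast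
qed

section \<open>Range of the spectral radius of the open matrix\<close>

lemma spectral_radius_nonneg: "spectral_radius (Lang A d) open_mat \<ge> 0"
  by (metis Lang_nonempty finite_Lang norm_ge_zero spectral_radius_attained)

text \<open>The row \<open>X\<close> bounding the powers of an eigenvalue of maximal modulus does
  not depend on \<open>n\<close>, so one \<open>n\<close> with row sum below 1 suffices.\<close>

lemma spectral_radius_less_1: "spectral_radius (Lang A d) open_mat < 1"
proof -
  obtain z where z: "is_eigenvalue (Lang A d) open_mat z"
    "cmod z = spectral_radius (Lang A d) open_mat"
    using spectral_radius_attained[OF finite_Lang Lang_nonempty] .
  obtain X where X: "X \<in> Lang A d" "\<And>n. cmod z ^ n \<le> row_mass n X"
    using cmod_eigenvalue_power_le[OF finite_Lang open_mat_nonneg z(1)] by blast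
  obtain n where "row_mass n X < 1" using ex_row_mass_less_1[OF X(1)] by blast
  then have "cmod z ^ n < 1" using X(2)[of n] by linarith
  then have "cmod z < 1" by (metis not_less one_le_power)
  then show ?thesis using z(2) by simp
qed

section \<open>Total weight of the words avoiding \<open>G\<close>\<close>

definition avoiding_mass :: "nat \<Rightarrow> real" where
  "avoiding_mass n = (\<Sum>w | w \<in> Lang A n \<and> avoids w. markov_cyl P p w)"

text \<open>A word of \<open>G\<close> that occurs in \<open>w @ [y]\<close> but not in
  \<open>w\<close> ends at \<open>y\<close>, hence lies within the last \<open>Suc d\<close>
  letters. For \<open>n = 0\<close> that window is the whole word.\<close>

lemma avoids_snoc_iff:
  assumes w: "length w = n + d"
  shows "avoids (w @ [y]) \<longleftrightarrow> (n = 0 \<or> avoids w) \<and> avoids (drop n w @ [y])"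
proof -
  have suf: "suffix (drop n w @ [y]) (w @ [y])"
    by (simp add: suffix_drop)
  have "sublist u (w @ [y]) \<longleftrightarrow> sublist u w \<or> sublist u (drop n w @ [y])" if "u \<in> G" for u
  proof
    assume "sublist u (w @ [y])"
    moreover have "suffix u (drop n w @ [y])" if "suffix u (w @ [y])"
      using that suf G_length[OF \<open>u \<in> G\<close>] w by (intro suffix_length_suffix[OF that suf]) simp
    ultimately show "sublist u w \<or> sublist u (drop n w @ [y])"
      unfolding sublist_snoc[of u w] using suffix_imp_sublist by blast
  next
    assume "sublist u w \<or> sublist u (drop n w @ [y])"
    then show "sublist u (w @ [y])"
      using suffix_imp_sublist[OF suf] sublist_order.order_trans sublist_append_rightI by blast
  qed
  moreover have "sublist u w \<Longrightarrow> sublist u (w @ [y])" for u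
    using sublist_order.order_trans sublist_append_rightI by blast
  ultimately show ?thesis unfolding avoids_def by (cases "n = 0") auto
qed

text \<open>Here \<open>j\<close> letters have already been appended to an initial word of length \<open>d\<close>, and \<open>row_mass\<close>
  accounts for the remaining ones. Condition \<open>j = 0\<close> is needed as the row and column labels of the
  matrix may themselves contain words of \<open>G\<close>.\<close>

lemma sum_markov_cyl_row_mass_Suc:
  defines "W \<equiv> \<lambda>j. {w \<in> Lang A (j + d). j = 0 \<or> avoids w}"
  shows "(\<Sum>w\<in>W j. markov_cyl P p w * row_mass (Suc k) (drop j w)) =
    (\<Sum>w\<in>W (Suc j). markov_cyl P p w * row_mass k (drop (Suc j) w))"
proof -
  let ?h = "\<lambda>(w, y). if avoids (drop j w @ [y])
    then markov_cyl P p w * (P (last w) y * row_mass k (tl (drop j w) @ [y])) else 0"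
  let ?T = "{(w, y). w \<in> W j \<and> avoids (drop j w @ [y]) \<and> edge (last w) y}"
  have fin: "finite (W j)" by (simp add: W_def finite_Lang)
  have drop_Lang: "drop j w \<in> Lang A d" and last_drop: "last (drop j w) = last w"
    and ne: "w \<noteq> []" and len: "length w = j + d" if "w \<in> W j" for w
  proof -
    from that have w: "length w = j + d" "successively edge w" by (auto simp: W_def Lang_iff)
    then have "successively edge (take j w @ drop j w)" by simp
    then show "drop j w \<in> Lang A d"
      using w(1) unfolding successively_append_iff Lang_iff by simp
    show "last (drop j w) = last w" "w \<noteq> []" "length w = j + d"
      using w(1) d_pos by auto
  qed
  have "(\<Sum>w\<in>W j. markov_cyl P p w * row_mass (Suc k) (drop j w)) = (\<Sum>w\<in>W j. \<Sum>y\<in>UNIV. ?h (w, y))"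
  proof (rule sum.cong[OF refl])
    fix w assume w: "w \<in> W j"
    show "markov_cyl P p w * row_mass (Suc k) (drop j w) = (\<Sum>y\<in>UNIV. ?h (w, y))"
      unfolding row_mass_Suc[OF drop_Lang[OF w]] sum_distrib_left
      by (intro sum.cong) (simp_all add: last_drop[OF w])
  qed
  also have "\<dots> = sum ?h (W j \<times> UNIV)"
    by (simp add: sum.cartesian_product)
  also have "\<dots> = sum ?h ?T"
    using fin by (intro sum.mono_neutral_right) (auto simp: P_eq_0_iff split: if_splits)
  also have "\<dots> = (\<Sum>w\<in>W (Suc j). markov_cyl P p w * row_mass k (drop (Suc j) w))"
  \<comment> \<open>Appending \<open>y\<close> matches pairs with words one letter longer:
    \<open>avoids_snoc_iff\<close> compares the conditions and \<open>markov_cyl_snoc\<close> the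
    weights.\<close>
  proof (rule sum.reindex_bij_witness[of _ "\<lambda>w. (butlast w, last w)" "\<lambda>(w, y). w @ [y]"])
    fix a assume "a \<in> ?T"
    then obtain w y where a: "a = (w, y)" and w: "w \<in> W j" and y: "avoids (drop j w @ [y])"
      "edge (last w) y" by auto
    show "(butlast (case a of (w, y) \<Rightarrow> w @ [y]), last (case a of (w, y) \<Rightarrow> w @ [y])) = a"
      by (simp add: a)
    show "(case a of (w, y) \<Rightarrow> w @ [y]) \<in> W (Suc j)"
      using w y d_pos avoids_snoc_iff[OF len[OF w], of y]
      by (simp add: a W_def Lang_snoc_iff)
    have "drop (Suc j) (w @ [y]) = tl (drop j w) @ [y]"
      using len[OF w] d_pos by (simp add: drop_Suc tl_drop)
    then show "markov_cyl P p (case a of (w, y) \<Rightarrow> w @ [y]) *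
        row_mass k (drop (Suc j) (case a of (w, y) \<Rightarrow> w @ [y])) = ?h a"
      using y by (simp add: a markov_cyl_snoc[OF ne[OF w]])
  next
    fix v assume v: "v \<in> W (Suc j)"
    then have "v \<noteq> []" by (auto simp: W_def Lang_def)
    then obtain w y where vw: "v = w @ [y]" by (metis append_butlast_last_id)
    have "length w = j + d" using v by (simp add: W_def vw Lang_def)
    then show "(butlast v, last v) \<in> ?T"
      using v d_pos avoids_snoc_iff[of w j y] by (simp add: W_def vw Lang_snoc_iff)
    show "(case (butlast v, last v) of (w, y) \<Rightarrow> w @ [y]) = v" using \<open>v \<noteq> []\<close> by simp
  qed
  finally show ?thesis .
qed

text \<open>All \<open>n\<close> letters are moved one by one from the row sum into the word. Only
  for \<open>n > 0\<close> does the final index set impose avoidance.\<close>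

lemma avoiding_mass_eq:
  assumes "n > 0"
  shows "avoiding_mass (n + d) = (\<Sum>X\<in>Lang A d. markov_cyl P p X * row_mass n X)"
proof -
  define T where "T j k = (\<Sum>w\<in>{w \<in> Lang A (j + d). j = 0 \<or> avoids w}.
    markov_cyl P p w * row_mass k (drop j w))" for j k
  have step: "T j (Suc k) = T (Suc j) k" for j k
    unfolding T_def by (rule sum_markov_cyl_row_mass_Suc)
  have "T 0 (j + k) = T j k" for j k
    by (induction j arbitrary: k) (simp_all add: step flip: add_Suc_right)
  from this[of n 0] show ?thesis using assms by (simp add: T_def avoiding_mass_def)
qed

text \<open>The constant is the Markov weight of the block whose row sums dominate the powers of the
  spectral radius; the other summands are nonnegative.\<close>

lemma avoiding_mass_lower:
  obtains c where "c > 0"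
    "\<And>n. n > 0 \<Longrightarrow> c * spectral_radius (Lang A d) open_mat ^ n \<le> avoiding_mass (n + d)"
proof -
  obtain z where z: "is_eigenvalue (Lang A d) open_mat z"
    "cmod z = spectral_radius (Lang A d) open_mat"
    using spectral_radius_attained[OF finite_Lang Lang_nonempty] .
  obtain X where X: "X \<in> Lang A d" "\<And>n. cmod z ^ n \<le> row_mass n X"
    using cmod_eigenvalue_power_le[OF finite_Lang open_mat_nonneg z(1)] by blast
  have pos: "markov_cyl P p Y > 0" if "Y \<in> Lang A d" for Y
    using that markov_cyl_pos by (simp add: Lang_iff)
  have "markov_cyl P p X * spectral_radius (Lang A d) open_mat ^ n \<le> avoiding_mass (n + d)"
    if "n > 0" for n
  proof -
    have "markov_cyl P p X * cmod z ^ n \<le> markov_cyl P p X * row_mass n X"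
      using X(2)[of n] pos[OF X(1)] by simp
    also have "\<dots> \<le> avoiding_mass (n + d)"
      unfolding avoiding_mass_eq[OF that]
      using X(1) finite_Lang pos row_mass_nonneg
      by (intro member_le_sum) (auto simp: less_imp_le)
    finally show ?thesis by (simp add: z(2))
  qed
  then show ?thesis using that pos[OF X(1)] by blast
qed

lemma avoiding_mass_upper:
  assumes t: "t > 0" "t > spectral_radius (Lang A d) open_mat"
  obtains C where "\<And>n. n > 0 \<Longrightarrow> avoiding_mass (n + d) \<le> C * t ^ n"
proof -
  obtain C where C: "\<And>n X. X \<in> Lang A d \<Longrightarrow> row_mass n X \<le> C * t ^ n"
    using power_row_sum_bound[OF finite_Lang Lang_nonempty t] by blast
  have "avoiding_mass (n + d) \<le> ((\<Sum>X\<in>Lang A d. markov_cyl P p X) * C) * t ^ n" if "n > 0" for n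
  proof -
    have "avoiding_mass (n + d) \<le> (\<Sum>X\<in>Lang A d. markov_cyl P p X * (C * t ^ n))"
      unfolding avoiding_mass_eq[OF that] using C markov_cyl_pos
      by (intro sum_mono mult_left_mono) (auto simp: Lang_iff less_imp_le)
    then show ?thesis by (simp add: sum_distrib_right mult.assoc)
  qed
  then show ?thesis using that by blast
qed

section \<open>Survivors and their measure\<close>

lemma shift_notin_hole_iff:
  assumes "x \<in> SFT A"
  shows "shift i x \<notin> hole A G \<longleftrightarrow> (\<forall>u\<in>G. map x [i..<i + length u] \<noteq> u)"
proof -
  have "shift i x \<in> SFT A"
    using assms by (simp add: SFT_def shift_def)
  moreover have "map x [i..<i + length u] = map (shift i x) [0..<length u]" for u :: "'a list"
    by (rule nth_equalityI) (simp_all add: shift_def add.commute)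
  moreover have "map y [0..<length u] = u \<longleftrightarrow> (\<forall>k<length u. y k = u ! k)" for y and u :: "'a list"
    unfolding list_eq_iff_nth_eq[of "map y [0..<length u]"] by simp
  ultimately have "shift i x \<in> cyl A u \<longleftrightarrow> map x [i..<i + length u] = u" for u
    by (simp add: cyl_def)
  then show ?thesis by (auto simp: hole_def)
qed

text \<open>Words of \<open>G\<close> starting at a position up to \<open>m\<close> end within the
  first \<open>Suc m + d\<close> letters. Survival is thus decided by a prefix, which also gives
  measurability.\<close>

lemma survivors_eq:
  "survivors A (hole A G) m = {x \<in> SFT A.
    \<forall>i\<le>m. \<forall>u\<in>G. take (length u) (drop i (map x [0..<Suc m + d])) \<noteq> u}"
proof -
  have "take (length u) (drop i (map x [0..<Suc m + d])) = map x [i..<i + length u]"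
    if "i \<le> m" "u \<in> G" for x :: "nat \<Rightarrow> 'a" and i u
    using that G_length[OF that(2)] by (simp add: take_map drop_map del: upt_Suc)
  then show ?thesis
    unfolding survivors_def
    by (intro Collect_cong conj_cong refl) (simp add: shift_notin_hole_iff del: upt_Suc add_Suc)
qed

lemma survivors_superset:
  "{x \<in> SFT A. avoids (map x [0..<Suc m + d])} \<subseteq> survivors A (hole A G) m"
proof -
  have "take (length u) (drop i w) \<noteq> u" if "avoids w" "u \<in> G" for u w i
  proof
    assume "take (length u) (drop i w) = u"
    then have "sublist u w"
      using sublist_order.order_trans[OF sublist_take sublist_drop, of "length u" i w] by simp
    then show False using that by (auto simp: avoids_def)
  qed
  then show ?thesis unfolding survivors_eq by blast
qed

lemma survivors_subset:
  "survivors A (hole A G) m \<subseteq> {x \<in> SFT A. avoids (map x [0..<Suc m])}"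
proof
  fix x assume x: "x \<in> survivors A (hole A G) m"
  then have SFT: "x \<in> SFT A" by (simp add: survivors_def)
  have "avoids (map x [0..<Suc m])"
    unfolding avoids_def
  proof (intro notI, elim bexE)
    fix u assume u: "u \<in> G" "sublist u (map x [0..<Suc m])"
    then obtain ps ss where eq: "map x [0..<Suc m] = ps @ u @ ss" by (auto simp: sublist_def)
    have len: "Suc m = length ps + length u + length ss"
      using arg_cong[OF eq, of length] by simp
    have "u = take (length u) (drop (length ps) (map x [0..<Suc m]))"
      unfolding eq by simp
    also have "\<dots> = map x [length ps..<length ps + length u]"
      using len by (simp add: take_map drop_map del: upt_Suc)
    finally have "shift (length ps) x \<in> hole A G"
      using u(1) shift_notin_hole_iff[OF SFT] by metis
    \<comment> \<open>As \<open>u\<close> is nonempty, its occurrence starts no later than position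
      \<open>m\<close>.\<close>
    moreover have "length ps \<le> m"
      using len G_allowed[OF u(1)] by (cases u) auto
    ultimately show False using x by (auto simp: survivors_def)
  qed
  then show "x \<in> {x \<in> SFT A. avoids (map x [0..<Suc m])}" using SFT by simp
qed

lemma measure_survivors_bounds:
  fixes M :: "(nat \<Rightarrow> 'a) measure"
  assumes M_sets: "sets M = sigma_sets (SFT A) {cyl A w | w. allowed A w}"
    and M_cyl: "\<forall>w. allowed A w \<and> w \<noteq> [] \<longrightarrow> emeasure M (cyl A w) = ennreal (markov_cyl P p w)"
  shows "avoiding_mass (Suc m + d) \<le> measure M (survivors A (hole A G) m)"
    "measure M (survivors A (hole A G) m) \<le> avoiding_mass (Suc m)"
proof -
  note event = prefix_event[OF M_sets M_cyl]
  have nonneg: "avoiding_mass n \<ge> 0" for n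
    unfolding avoiding_mass_def using markov_cyl_pos
    by (intro sum_nonneg) (auto simp: Lang_iff less_imp_le)
  \<comment> \<open>Finite mass matters here: \<open>measure\<close> sends infinite mass to 0, so
    monotonicity needs \<open>fmeasurable\<close> sets.\<close>
  have mass: "{x \<in> SFT A. avoids (map x [0..<n])} \<in> fmeasurable M"
    "measure M {x \<in> SFT A. avoids (map x [0..<n])} = avoiding_mass n" if "n > 0" for n
    using event[OF that, of avoids] nonneg[of n]
    by (simp_all add: fmeasurable_def measure_def flip: avoiding_mass_def)
  have surv: "survivors A (hole A G) m \<in> sets M"
    unfolding survivors_eq by (rule event) simp
  show "measure M (survivors A (hole A G) m) \<le> avoiding_mass (Suc m)"
    using measure_mono_fmeasurable[OF survivors_subset surv mass(1)] mass(2)[of "Suc m"] by simp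
  have "survivors A (hole A G) m \<in> fmeasurable M"
    using fmeasurableI2[OF mass(1) survivors_subset surv] by simp
  then show "avoiding_mass (Suc m + d) \<le> measure M (survivors A (hole A G) m)"
    using measure_mono_fmeasurable[OF survivors_superset fmeasurableD[OF mass(1)], of m]
      mass(2)[of "Suc m + d"] by (simp del: upt_Suc)
qed

section \<open>Identification of the open matrix with the Hadamard product\<close>

lemma hadamard_eq_open_mat:
  assumes "d = r - 1" "r > 1"
  shows "hadamard (Bmat A G r) (Pprev A P r) X Y = open_mat X Y"
proof -
  have "r = Suc d" "r \<noteq> Suc 0" using assms by simp_all
  then show ?thesis
    by (simp add: hadamard_def Bmat_def Pprev_def Pblock_def open_mat_def avoids_def compat_def
        star_def)
qed

text \<open>A window of two letters avoids a set of one-letter words exactly if neither letter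
  belongs to it, which is the condition in \<open>Bmat\<close> for \<open>r = 1\<close>.\<close>

lemma hadamard_eq_open_mat_letters:
  assumes G1: "\<And>u. u \<in> G \<Longrightarrow> length u = 1" and d: "d = 1"
    and XY: "X \<in> Lang A 1" "Y \<in> Lang A 1"
  shows "hadamard (Bmat A G 1) (Pprev A P 1) X Y = open_mat X Y"
proof -
  obtain x y where xy: "X = [x]" "Y = [y]"
    using XY by (auto simp: Lang_def length_Suc_conv)
  have "avoids [x, y] \<longleftrightarrow> [x] \<notin> G \<and> [y] \<notin> G"
  proof -
    have "sublist u [x, y] \<longleftrightarrow> u = [x] \<or> u = [y]" if u: "u \<in> G" for u
    proof -
      obtain c where "u = [c]" using G1[OF u] by (auto simp: length_Suc_conv)
      then show ?thesis by (auto simp: sublist_Cons_right)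
    qed
    then show ?thesis unfolding avoids_def by blast
  qed
  then have "open_mat X Y = (if [x, y] \<in> Lang A 2 \<and> [x] \<notin> G \<and> [y] \<notin> G then P x y else 0)"
    unfolding open_mat_def by (simp add: xy d numeral_2_eq_2)
  then show ?thesis
    unfolding hadamard_def Bmat_def Pprev_def by (simp add: xy)
qed

end

theorem theorem3p1:
  fixes A P :: "'a::finite \<Rightarrow> 'a \<Rightarrow> real"
    and p :: "'a \<Rightarrow> real"
    and M :: "(nat \<Rightarrow> 'a) measure"
    and G :: "'a list set"
  assumes A01: "\<forall>i j. A i j = 0 \<or> A i j = 1"
    and A_irr: "irreducible_mat A"
    and P_nonneg: "\<forall>i j. P i j \<ge> 0"
    and P_stoch: "\<forall>i. (\<Sum>j\<in>UNIV. P i j) = 1"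
    and P_compat: "\<forall>i j. P i j > 0 \<longleftrightarrow> A i j = 1"
    and p_stat: "\<forall>j. (\<Sum>i\<in>UNIV. p i * P i j) = p j"
    and p_sum: "(\<Sum>i\<in>UNIV. p i) = 1"
    and M_space: "space M = SFT A"
    and M_sets: "sets M = sigma_sets (SFT A) {cyl A w | w. allowed A w}"
    and M_cyl: "\<forall>w. allowed A w \<and> w \<noteq> [] \<longrightarrow> emeasure M (cyl A w) = ennreal (markov_cyl P p w)"
    and G_fin: "finite G" and G_ne: "G \<noteq> {}"
    and G_allowed: "\<forall>w\<in>G. allowed A w \<and> w \<noteq> []"
  shows "let r = Max (length ` G);
             lam = spectral_radius (open_index A r) (hadamard (Bmat A G r) (Pprev A P r))
         in ((\<lambda>m. - ln_ereal (measure M (survivors A (hole A G) m)) / ereal (real m))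
               \<longlonglongrightarrow> - ln_ereal lam)
            \<and> - ln_ereal lam > 0"
proof -
  define r where "r = Max (length ` G)"
  define d where "d = (if r = 1 then 1 else r - 1)"
  define lam where "lam = spectral_radius (open_index A r) (hadamard (Bmat A G r) (Pprev A P r))"
  define a where "a m = measure M (survivors A (hole A G) m)" for m
  have len_le: "length u \<le> r" if "u \<in> G" for u
    unfolding r_def using that G_fin by simp
  obtain u where "u \<in> G" using G_ne by blast
  then have "r \<ge> 1"
    using len_le[of u] G_allowed by (cases u) auto
  interpret markov_sft A P p
    using A01 A_irr P_nonneg P_stoch P_compat p_stat p_sum by (intro markov_sft.intro) blast+
  interpret open_markov_sft A P p G d
  proof
    show "G \<noteq> {}" by (rule G_ne)
    show "allowed A u \<and> u \<noteq> []" if "u \<in> G" for u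
      using G_allowed that by blast
    show "length u \<le> Suc d" if "u \<in> G" for u
      using len_le[OF that] \<open>r \<ge> 1\<close> by (simp add: d_def)
    show "d > 0" using \<open>r \<ge> 1\<close> by (simp add: d_def)
  qed
  have lam_eq: "lam = spectral_radius (Lang A d) open_mat"
  proof (cases "r = 1")
    case True
    have "length u = 1" if "u \<in> G" for u
      using len_le[OF that] G_allowed that True by (cases u) auto
    then have "hadamard (Bmat A G r) (Pprev A P r) X Y = open_mat X Y"
      if "X \<in> Lang A d" "Y \<in> Lang A d" for X Y
      using hadamard_eq_open_mat_letters[of X Y] that True by (simp add: d_def)
    moreover have "open_index A r = Lang A d" using True by (simp add: open_index_def d_def)
    ultimately show ?thesis
      unfolding lam_def using spectral_radius_cong[of "Lang A d"] by metis
  next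
    case False
    then have "d = r - 1" "r > 1" using \<open>r \<ge> 1\<close> by (simp_all add: d_def)
    then have "hadamard (Bmat A G r) (Pprev A P r) = open_mat"
      by (intro ext hadamard_eq_open_mat)
    moreover have "open_index A r = Lang A d" using False by (simp add: open_index_def d_def)
    ultimately show ?thesis unfolding lam_def by simp
  qed
  note bounds = measure_survivors_bounds[OF M_sets M_cyl, folded a_def]
  obtain c where c: "c > 0" "\<And>n. n > 0 \<Longrightarrow> c * lam ^ n \<le> avoiding_mass (n + d)"
    using avoiding_mass_lower unfolding lam_eq by blast
  have "(\<lambda>m. - ln_ereal (a m) / ereal (real m)) \<longlonglongrightarrow> - ln_ereal lam"
  proof (rule escape_rate_limit)
    show "lam \<ge> 0" using spectral_radius_nonneg by (simp add: lam_eq)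
    show "c > 0" by fact
    show "c * lam ^ Suc m \<le> a m" for m
      using c(2)[of "Suc m"] bounds(1)[of m] by simp
    fix t assume t: "0 < t" "lam < t"
    then obtain C where C: "\<And>n. n > 0 \<Longrightarrow> avoiding_mass (n + d) \<le> C * t ^ n"
      using avoiding_mass_upper[of t] unfolding lam_eq by blast
    \<comment> \<open>The upper bound involves words of length \<open>Suc m\<close>, that is, blocks
      of length \<open>d\<close> with \<open>Suc (m - d)\<close> letters appended; this accounts for
      the factor \<open>t / t ^ d\<close>.\<close>
    have "a m \<le> C * t / t ^ d * t ^ m" if "m \<ge> d" for m
    proof -
      define k where "k = m - d"
      have k: "m = k + d" using that by (simp add: k_def)
      have "a m \<le> avoiding_mass (Suc k + d)" using bounds(2)[of m] by (simp add: k)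
      also have "\<dots> \<le> C * t ^ Suc k" by (rule C) simp
      also have "\<dots> = C * t / t ^ d * t ^ m" using t by (simp add: k power_add)
      finally show ?thesis .
    qed
    then show "\<exists>C. \<forall>\<^sub>F m in sequentially. a m \<le> C * t ^ m"
      unfolding eventually_sequentially by blast
  qed
  \<comment> \<open>For \<open>lam = 0\<close> the rate is \<infinity>, which is positive as
    well.\<close>
  moreover have "- ln_ereal lam > 0"
    using spectral_radius_less_1 by (simp add: lam_eq ln_ereal_def)
  ultimately show ?thesis
    by (simp only: Let_def flip: r_def lam_def a_def)
qed

end
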